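(* Let $H$ be a complex Hilbert space, $n\ge2$, and $\mathbf{A}=(A_1,\dots,A_n)$, $\mathbf{B}=(B_1,\dots,B_n)$ with $A_k,B_k\in\mathcal{B}_2(H)$ for all $k$. For $\mathbf{P}=(P_1,\dots,P_n)\in\mathcal{B}_+^{(n)}(H)$ put $$\sigma_{\mathbf{A},\mathbf{B}}(\mathbf{P}):=\left[\operatorname{tr}\left(\sum_{k=1}^nP_k|A_k|^2\right)\right]^{1/2}\left[\operatorname{tr}\left(\sum_{k=1}^nP_k|B_k|^2\right)\right]^{1/2}-\left|\operatorname{tr}\left(\sum_{k=1}^nP_kA_k^*B_k\right)\right|.$$ (i) For any $\mathbf{P},\mathbf{Q}\in\mathcal{B}_+^{(n)}(H)$, $$\sigma_{\mathbf{A},\mathbf{B}}(\mathbf{P}+\mathbf{Q})\ge\sigma_{\mathbf{A},\mathbf{B}}(\mathbf{P})+\sigma_{\mathbf{A},\mathbf{B}}(\mathbf{Q})\ (\ge0),$$ i.e. $\sigma_{\mathbf{A},\mathbf{B}}$ is superadditive on $\mathcal{B}_+^{(n)}(H)$. (ii) For any $\mathbf{P},\mathbf{Q}\in\mathcal{B}_+^{(n)}(H)$ with $\mathbf{P}\ge\mathbf{Q}$, i.e. $P_k\ge Q_k$ for all $k\in\{1,\dots,n\}$, $$\sigma_{\mathbf{A},\mathbf{B}}(\mathbf{P})\ge\sigma_{\mathbf{A},\mathbf{B}}(\mathbf{Q})\ (\ge0),$$ i.e. $\sigma_{\mathbf{A},\mathbf{B}}$ is monotonic nondecreasing on $\mathcal{B}_+^{(n)}(H)$.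 (iii) If $\mathbf{P},\mathbf{Q}\in\mathcal{B}_+^{(n)}(H)$ and there exist constants $M>m>0$ such that $M\mathbf{Q}\ge\mathbf{P}\ge m\mathbf{Q}$, then $$M\sigma_{\mathbf{A},\mathbf{B}}(\mathbf{Q})\ge\sigma_{\mathbf{A},\mathbf{B}}(\mathbf{P})\ge m\sigma_{\mathbf{A},\mathbf{B}}(\mathbf{Q})\ (\ge0).$$
   Context: $\mathcal{B}(H)$ is the algebra of bounded linear operators on $H$; $\mathcal{B}_+(H)$ is the convex cone of nonnegative selfadjoint operators in $\mathcal{B}(H)$ ($\langle Px,x\rangle\ge0$ for all $x\in H$), and $P\ge Q$ means $P-Q\in\mathcal{B}_+(H)$. $\mathcal{B}_+^{(n)}(H)=\mathcal{B}_+(H)\times\dots\times\mathcal{B}_+(H)$ ($n$ factors), with addition, multiplication by scalars and order taken componentwise. $\mathcal{B}_2(H)$ is the set of Hilbert-Schmidt operators, i.e. $A\in\mathcal{B}(H)$ with $\sum_{i\in I}\|Ae_i\|^2<\infty$ for an (equivalently every) orthonormal basis $\{e_i\}_{i\in I}$ of $H$. $|A|:=(A^*A)^{1/2}$. For a trace class operator $T$, $\operatorname{tr}(T)=\sum_{i\in I}\langle Te_i,e_i\rangle$; the product of two Hilbert-Schmidt operators is trace class, and so is the product of a bounded and a trace class operator. *)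

theory Defs
  imports "HOL-Analysis.Analysis"
begin

(* A complex Hilbert space is a real Hilbert space with a compatible complex structure:
   the real inner product is the real part of the complex one, so norm x = sqrt (Re <x, x>).
   The complex inner product is linear in its first argument. *)
class complex_hilbert = real_inner + complete_space +
  fixes scaleC :: "complex \<Rightarrow> 'a \<Rightarrow> 'a"
    and cinner :: "'a \<Rightarrow> 'a \<Rightarrow> complex"
  assumes scaleC_add_right: "scaleC c (x + y) = scaleC c x + scaleC c y"
    and scaleC_add_left: "scaleC (c + d) x = scaleC c x + scaleC d x"
    and scaleC_scaleC: "scaleC c (scaleC d x) = scaleC (c * d) x"
    and scaleC_of_real: "scaleC (complex_of_real r) x = scaleR r x"
    and cinner_commute: "cinner x y = cnj (cinner y x)"
    and cinner_add_left: "cinner (x + y) z = cinner x z + cinner y z"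
    and cinner_scaleC_left: "cinner (scaleC c x) y = c * cinner x y"
    and Re_cinner: "Re (cinner x y) = inner x y"

instance complex_hilbert \<subseteq> banach ..

instantiation complex :: complex_hilbert
begin

definition scaleC_complex :: "complex \<Rightarrow> complex \<Rightarrow> complex"
  where "scaleC_complex c x = c * x"

definition cinner_complex :: "complex \<Rightarrow> complex \<Rightarrow> complex"
  where "cinner_complex x y = x * cnj y"

instance
  by standard
    (simp_all add: scaleC_complex_def cinner_complex_def algebra_simps scaleR_conv_of_real
      inner_complex_def)

end

global_interpretation complex_vector:
  vector_space "scaleC :: complex \<Rightarrow> 'a \<Rightarrow> 'a::complex_hilbert"
proof
  fix x :: 'a
  show "scaleC 1 x = x"
    using scaleC_of_real[of 1 x] by simp
qed (simp_all add: scaleC_add_right scaleC_add_left scaleC_scaleC)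

(* Elements of the type 'a \<Rightarrow>\<^sub>L 'a are only real-linear; B(H) consists of the
   complex-linear ones. *)
definition bounded_ops :: "('a::complex_hilbert \<Rightarrow>\<^sub>L 'a) set"
  where "bounded_ops = {T. \<forall>c x. blinfun_apply T (scaleC c x) = scaleC c (blinfun_apply T x)}"

definition adj :: "('a::complex_hilbert \<Rightarrow>\<^sub>L 'a) \<Rightarrow> 'a \<Rightarrow>\<^sub>L 'a"
  where "adj T = (THE S. S \<in> bounded_ops \<and>
           (\<forall>x y. cinner (blinfun_apply T x) y = cinner x (blinfun_apply S y)))"

definition nonneg_ops :: "('a::complex_hilbert \<Rightarrow>\<^sub>L 'a) set"
  where "nonneg_ops = {P \<in> bounded_ops. adj P = P \<and> (\<forall>x. 0 \<le> Re (cinner (blinfun_apply P x) x))}"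

definition op_le :: "('a::complex_hilbert \<Rightarrow>\<^sub>L 'a) \<Rightarrow> ('a \<Rightarrow>\<^sub>L 'a) \<Rightarrow> bool"
  where "op_le Q P \<longleftrightarrow> P - Q \<in> nonneg_ops"

(* The nonnegative square root of a nonnegative operator is unique, so the choice
   is determined. *)
definition op_sqrt :: "('a::complex_hilbert \<Rightarrow>\<^sub>L 'a) \<Rightarrow> 'a \<Rightarrow>\<^sub>L 'a"
  where "op_sqrt T = (SOME R. R \<in> nonneg_ops \<and> R o\<^sub>L R = T)"

definition op_abs :: "('a::complex_hilbert \<Rightarrow>\<^sub>L 'a) \<Rightarrow> 'a \<Rightarrow>\<^sub>L 'a"
  where "op_abs A = op_sqrt (adj A o\<^sub>L A)"

definition is_onb :: "('a::complex_hilbert) set \<Rightarrow> bool"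
  where "is_onb E \<longleftrightarrow>
           (\<forall>e\<in>E. \<forall>f\<in>E. cinner e f = (if e = f then 1 else 0)) \<and>
           closure (complex_vector.span E) = UNIV"

definition hilbert_schmidt :: "('a::complex_hilbert \<Rightarrow>\<^sub>L 'a) set"
  where "hilbert_schmidt = {A \<in> bounded_ops.
           \<exists>E. is_onb E \<and> (\<lambda>e. (norm (blinfun_apply A e))\<^sup>2) summable_on E}"

(* For trace class T the sum converges absolutely and does not depend on the
   orthonormal basis chosen. *)
definition tr :: "('a::complex_hilbert \<Rightarrow>\<^sub>L 'a) \<Rightarrow> complex"
  where "tr T = (\<Sum>\<^sub>\<infinity>e\<in>(SOME E. is_onb E). cinner (blinfun_apply T e) e)"

(* n-tuples of operators are functions on nat of which only the values at 1, ..., n matter.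
   The traces under the square roots are nonnegative reals when P k is nonnegative and
   A k, B k are Hilbert-Schmidt, as tr (P |A|^2) = tr (|A| P |A|); Re only changes the type. *)
definition sigma_tr ::
  "nat \<Rightarrow> (nat \<Rightarrow> 'a::complex_hilbert \<Rightarrow>\<^sub>L 'a) \<Rightarrow> (nat \<Rightarrow> 'a \<Rightarrow>\<^sub>L 'a) \<Rightarrow> (nat \<Rightarrow> 'a \<Rightarrow>\<^sub>L 'a) \<Rightarrow> real"
  where "sigma_tr n A B P =
           sqrt (Re (tr (\<Sum>k=1..n. P k o\<^sub>L (op_abs (A k) o\<^sub>L op_abs (A k))))) *
           sqrt (Re (tr (\<Sum>k=1..n. P k o\<^sub>L (op_abs (B k) o\<^sub>L op_abs (B k))))) -
           cmod (tr (\<Sum>k=1..n. P k o\<^sub>L (adj (A k) o\<^sub>L B k)))"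

definition nonneg_tuples :: "nat \<Rightarrow> (nat \<Rightarrow> 'a::complex_hilbert \<Rightarrow>\<^sub>L 'a) set"
  where "nonneg_tuples n = {P. \<forall>k\<in>{1..n}. P k \<in> nonneg_ops}"

definition tuple_le ::
  "nat \<Rightarrow> (nat \<Rightarrow> 'a::complex_hilbert \<Rightarrow>\<^sub>L 'a) \<Rightarrow> (nat \<Rightarrow> 'a \<Rightarrow>\<^sub>L 'a) \<Rightarrow> bool"
  where "tuple_le n Q P \<longleftrightarrow> (\<forall>k\<in>{1..n}. op_le (Q k) (P k))"

end

theory Submission
  imports Defs
begin

text \<open>By cyclicity, \<open>tr (\<Sum>k. P\<^sub>k A\<^sub>k\<^sup>* B\<^sub>k) = (\<Sum>e. \<Sum>k. \<langle>P\<^sub>k A\<^sub>k\<^sup>* e, B\<^sub>k\<^sup>* e\<rangle>)\<close>, which is a positive semidefinite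
  hermitian form in the pair \<open>(A, B)\<close> and additive and positively homogeneous in \<open>P\<close>; moreover
  \<open>|A|\<^sup>2 = A\<^sup>* A\<close>. So \<open>\<sigma> \<ge> 0\<close> is the Cauchy-Schwarz inequality for this form, and superadditivity is
  the triangle inequality for the modulus together with the Cauchy-Schwarz inequality in the plane,
  \<open>\<surd>a \<surd>b + \<surd>c \<surd>d \<le> \<surd>(a + c) \<surd>(b + d)\<close>. Monotonicity follows by writing \<open>P = Q + (P - Q)\<close>, and the
  two-sided bound from monotonicity and homogeneity.\<close>

section \<open>The complex inner product and the Riesz representation\<close>

lemma cinner_add_right: "cinner x (y + z) = cinner x y + cinner x z"
  for x :: "'a::complex_hilbert"
  by (metis cinner_add_left cinner_commute complex_cnj_add)

lemma cinner_scaleC_right: "cinner x (scaleC c y) = cnj c * cinner x y"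
  for x :: "'a::complex_hilbert"
  by (metis cinner_commute cinner_scaleC_left complex_cnj_mult)

lemma cinner_scaleR_left: "cinner (r *\<^sub>R x) y = of_real r * cinner x y"
  for x :: "'a::complex_hilbert"
  by (metis cinner_scaleC_left scaleC_of_real)

lemma cinner_scaleR_right: "cinner x (r *\<^sub>R y) = of_real r * cinner x y"
  for x :: "'a::complex_hilbert"
  by (metis cinner_scaleC_right scaleC_of_real complex_cnj_complex_of_real)

lemma cinner_zero_left [simp]: "cinner 0 y = 0" for y :: "'a::complex_hilbert"
  using cinner_add_left[of 0 0 y] by simp

lemma cinner_zero_right [simp]: "cinner y 0 = 0" for y :: "'a::complex_hilbert"
  using cinner_add_right[of y 0 0] by simp

lemma cinner_minus_left: "cinner (- x) y = - cinner x y" for x :: "'a::complex_hilbert"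
  using cinner_scaleR_left[of "-1" x y] by simp

lemma cinner_minus_right: "cinner x (- y) = - cinner x y" for x :: "'a::complex_hilbert"
  using cinner_scaleR_right[of x "-1" y] by simp

lemma cinner_diff_left: "cinner (x - y) z = cinner x z - cinner y z"
  for x :: "'a::complex_hilbert"
  using cinner_add_left[of x "- y" z] by (simp add: cinner_minus_left)

lemma cinner_diff_right: "cinner x (y - z) = cinner x y - cinner x z"
  for x :: "'a::complex_hilbert"
  using cinner_add_right[of x y "- z"] by (simp add: cinner_minus_right)

lemma cinner_sum_left: "cinner (sum f S) y = (\<Sum>i\<in>S. cinner (f i) y)"
  for y :: "'a::complex_hilbert"
  by (induction S rule: infinite_finite_induct) (auto simp: cinner_add_left)

lemma cinner_sum_right: "cinner y (sum f S) = (\<Sum>i\<in>S. cinner y (f i))"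
  for y :: "'a::complex_hilbert"
  by (induction S rule: infinite_finite_induct) (auto simp: cinner_add_right)

text \<open>Pulling \<open>\<i>\<close> out of the second argument produces the factor
  \<open>- \<i>\<close>, whose product with a number has that number's imaginary part as real part.
  With \<open>Re_cinner\<close> this lets complex identities be derived from real ones.\<close>

lemma Im_cinner: "Im (cinner x y) = inner x (scaleC \<i> y)" for x :: "'a::complex_hilbert"
  by (simp add: cinner_scaleC_right flip: Re_cinner)

lemma cinner_self: "cinner x x = of_real ((norm x)\<^sup>2)" for x :: "'a::complex_hilbert"
proof -
  have "cinner x x = cnj (cinner x x)" by (rule cinner_commute)
  then have "Im (cinner x x) = Im (cnj (cinner x x))" by (rule arg_cong)
  then have "Im (cinner x x) = 0" by simp
  then show ?thesis by (simp add: complex_eq_iff Re_cinner dot_square_norm)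
qed

lemma norm_scaleC: "norm (scaleC c x) = cmod c * norm x" for x :: "'a::complex_hilbert"
proof -
  have "of_real ((norm (scaleC c x))\<^sup>2) = cinner (scaleC c x) (scaleC c x)"
    by (rule cinner_self[symmetric])
  also have "\<dots> = (c * cnj c) * cinner x x"
    by (simp add: cinner_scaleC_left cinner_scaleC_right)
  also have "\<dots> = of_real ((cmod c * norm x)\<^sup>2)"
    by (simp add: cinner_self power_mult_distrib complex_norm_square[symmetric])
  finally have "(norm (scaleC c x))\<^sup>2 = (cmod c * norm x)\<^sup>2"
    using of_real_eq_iff by blast
  then show ?thesis by (simp add: power2_eq_iff_nonneg)
qed

lemma inner_scaleC_i: "inner (scaleC \<i> x) y = - inner x (scaleC \<i> y)" for x :: "'a::complex_hilbert"
  by (simp add: cinner_scaleC_right cinner_scaleC_left flip: Re_cinner)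

text \<open>The representing vector is the minimiser of the energy \<open>\<phi>\<close>, half the
  squared norm minus \<open>f\<close>: completeness provides the minimiser, and the vanishing of the
  first variation there is the claim.\<close>

lemma riesz_representation_real:
  fixes f :: "'a::{real_inner,complete_space} \<Rightarrow> real"
  assumes "bounded_linear f"
  obtains y where "\<And>x. f x = inner x y"
proof -
  interpret f: bounded_linear f by fact
  define \<phi> where "\<phi> x = (norm x)\<^sup>2 / 2 - f x" for x
  obtain K where K: "\<And>x. \<bar>f x\<bar> \<le> norm x * K"
    using f.bounded by (auto simp: real_norm_def)
  have lb: "\<phi> x \<ge> - K\<^sup>2 / 2" for x
  proof -
    have "f x \<le> norm x * K" using K[of x] by linarith
    moreover have "0 \<le> (norm x - K)\<^sup>2" by simp
    ultimately show ?thesis unfolding \<phi>_def by (simp add: power2_eq_square algebra_simps)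
  qed
  define I where "I = Inf (range \<phi>)"
  have bdd: "bdd_below (range \<phi>)" using lb by (auto intro!: bdd_belowI)
  have Ile: "I \<le> \<phi> x" for x unfolding I_def by (rule cInf_lower[OF _ bdd]) auto
  have "\<exists>x. \<phi> x < I + inverse (real (Suc n))" for n
    using cInf_lessD[of "range \<phi>" "I + inverse (real (Suc n))"] unfolding I_def by auto
  then obtain u where u: "\<And>n. \<phi> (u n) < I + inverse (real (Suc n))" by metis
  \<comment> \<open>The parallelogram law; the contributions of the linear functional
    \<open>f\<close> cancel.\<close>
  have par: "\<phi> x + \<phi> y - 2 * \<phi> ((1/2) *\<^sub>R (x + y)) = (norm (x - y))\<^sup>2 / 4" for x y
    unfolding \<phi>_def
    by (simp add: power2_norm_eq_inner f.scaleR f.add inner_commute algebra_simps field_simps)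
  \<comment> \<open>The midpoint has energy at least \<open>I\<close>, so two near-minimisers must
    be close to each other.\<close>
  have near: "(norm (u m - u n))\<^sup>2 \<le> 4 * (inverse (real (Suc m)) + inverse (real (Suc n)))" for m n
  proof -
    have "\<phi> (u m) + \<phi> (u n) - 2 * \<phi> ((1/2) *\<^sub>R (u m + u n))
      \<le> (I + inverse (real (Suc m))) + (I + inverse (real (Suc n))) - 2 * I"
      by (intro diff_mono add_mono mult_left_mono less_imp_le[OF u] Ile) simp
    then show ?thesis unfolding par by argo
  qed
  have "Cauchy u"
  proof (rule metric_CauchyI)
    fix e :: real assume "e > 0"
    then obtain N where N: "inverse (real (Suc N)) < e\<^sup>2 / 8"
      using reals_Archimedean[of "e\<^sup>2 / 8"] by auto
    show "\<exists>M. \<forall>m\<ge>M. \<forall>n\<ge>M. dist (u m) (u n) < e"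
    proof (intro exI[of _ N] allI impI)
      fix m n assume "m \<ge> N" "n \<ge> N"
      then have "inverse (real (Suc m)) \<le> inverse (real (Suc N))"
        "inverse (real (Suc n)) \<le> inverse (real (Suc N))"
        by (simp_all add: field_simps)
      then have "(norm (u m - u n))\<^sup>2 < e\<^sup>2" using near[of m n] N by argo
      then show "dist (u m) (u n) < e"
        using \<open>e > 0\<close> by (simp add: dist_norm power2_less_imp_less[of _ e])
    qed
  qed
  then obtain y where y: "u \<longlonglongrightarrow> y" using Cauchy_convergent convergent_def by blast
  have "(\<lambda>n. \<phi> (u n)) \<longlonglongrightarrow> \<phi> y"
    unfolding \<phi>_def by (intro tendsto_intros f.tendsto y) simp
  moreover have "(\<lambda>n. I + inverse (real (Suc n))) \<longlonglongrightarrow> I + 0"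
    by (intro tendsto_intros LIMSEQ_inverse_real_of_nat)
  ultimately have "\<phi> y \<le> I + 0"
    by (rule LIMSEQ_le) (use u in \<open>auto intro: less_imp_le\<close>)
  then have min: "\<phi> y \<le> \<phi> x" for x using Ile[of x] by linarith
  have "f h = inner h y" for h
  proof -
    define d where "d = inner h y - f h"
    have q: "0 \<le> t * d + t\<^sup>2 * (norm h)\<^sup>2 / 2" for t
      using min[of "y + t *\<^sub>R h"] unfolding \<phi>_def d_def power2_norm_eq_inner
      by (simp add: f.scaleR f.add inner_commute algebra_simps power2_eq_square)
    \<comment> \<open>The quadratic \<open>q\<close> is evaluated at \<open>t = - d / c\<close>,
      close to its minimiser; the added 1 keeps \<open>c\<close> positive when
      \<open>h = 0\<close>.\<close>
    define c where "c = (norm h)\<^sup>2 + 1"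
    have c: "c > 0" unfolding c_def by (simp add: add_nonneg_pos)
    have "0 \<le> (- d / c) * d + (- d / c)\<^sup>2 * (norm h)\<^sup>2 / 2" by (rule q)
    also have "\<dots> \<le> (- d / c) * d + (- d / c)\<^sup>2 * c / 2" unfolding c_def by (simp add: mult_left_mono divide_right_mono)
    also have "\<dots> = - (d\<^sup>2 / (2 * c))" using c by (simp add: power2_eq_square field_simps)
    finally have "d\<^sup>2 / (2 * c) \<le> 0" by simp
    then have "d = 0" using c by (simp add: divide_le_0_iff)
    then show ?thesis by (simp add: d_def)
  qed
  then show thesis by (rule that)
qed

section \<open>Adjoints and nonnegative operators\<close>

lemma bounded_linear_scaleC: "bounded_linear (scaleC c :: 'a::complex_hilbert \<Rightarrow> 'a)"
proof (rule bounded_linear_intro[where K = "cmod c"])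
  show "scaleC c (r *\<^sub>R x) = r *\<^sub>R scaleC c x" for r and x :: 'a
    by (simp add: scaleC_scaleC mult.commute flip: scaleC_of_real)
qed (simp_all add: scaleC_add_right norm_scaleC)

lemma bounded_ops_scaleC: "T \<in> bounded_ops \<Longrightarrow> T (scaleC c x) = scaleC c (T x)"
  by (simp add: bounded_ops_def)

lemma bounded_ops_zero: "0 \<in> bounded_ops"
  by (simp add: bounded_ops_def)

lemma bounded_ops_id: "id_blinfun \<in> bounded_ops"
  by (simp add: bounded_ops_def)

lemma bounded_ops_add: "S \<in> bounded_ops \<Longrightarrow> T \<in> bounded_ops \<Longrightarrow> S + T \<in> bounded_ops"
  by (simp add: bounded_ops_def blinfun.add_left scaleC_add_right)

lemma bounded_ops_diff: "S \<in> bounded_ops \<Longrightarrow> T \<in> bounded_ops \<Longrightarrow> S - T \<in> bounded_ops"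
  by (simp add: bounded_ops_def blinfun.diff_left complex_vector.scale_right_diff_distrib)

lemma bounded_ops_scaleR: "T \<in> bounded_ops \<Longrightarrow> r *\<^sub>R T \<in> bounded_ops"
  by (simp add: bounded_ops_def blinfun.scaleR_left scaleC_scaleC mult.commute flip: scaleC_of_real)

lemma bounded_ops_compose: "S \<in> bounded_ops \<Longrightarrow> T \<in> bounded_ops \<Longrightarrow> S o\<^sub>L T \<in> bounded_ops"
  by (simp add: bounded_ops_def)

lemma bounded_ops_lim:
  assumes "\<And>n. X n \<in> bounded_ops" "X \<longlonglongrightarrow> Y"
  shows "Y \<in> bounded_ops"
proof -
  have X: "(\<lambda>n. X n x) \<longlonglongrightarrow> Y x" for x
    by (intro tendsto_intros assms)
  have "Y (scaleC c x) = scaleC c (Y x)" for c x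
    using X[of "scaleC c x"] bounded_linear.tendsto[OF bounded_linear_scaleC X[of x], of c]
    by (simp add: bounded_ops_scaleC[OF assms(1)] LIMSEQ_unique)
  then show ?thesis by (simp add: bounded_ops_def)
qed

text \<open>Replacing \<open>y\<close> by \<open>scaleC \<i> y\<close> in the real relation yields
  the imaginary parts, because \<open>S\<close> commutes with complex scalars.\<close>

lemma cinner_adjointI:
  assumes "S \<in> bounded_ops" and "\<And>x y. inner (f x) y = inner x (blinfun_apply S y)"
  shows "cinner (f x) y = cinner x (blinfun_apply S y)"
  by (simp add: complex_eq_iff Re_cinner Im_cinner assms bounded_ops_scaleC)

lemma inner_ext:
  assumes "\<And>x. inner x y = inner x z"
  shows "y = z"
proof -
  have "inner (y - z) (y - z) = 0" using assms[of "y - z"] by (simp only: inner_diff_right)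
  then show ?thesis by simp
qed

text \<open>Real Riesz representation, applied for each \<open>y\<close> to the functional sending
  \<open>x\<close> to \<open>inner (T x) y\<close>, gives a function \<open>s\<close>. Since a
  vector is determined by its real inner products, \<open>s\<close> inherits real linearity, and
  complex linearity because a scalar \<open>c\<close> moves across the inner product as
  \<open>cnj c\<close>.\<close>

lemma ex_adjoint:
  assumes T: "T \<in> bounded_ops"
  shows "\<exists>S\<in>bounded_ops. \<forall>x y. cinner (blinfun_apply T x) y = cinner x (blinfun_apply S y)"
proof -
  have "\<exists>s. \<forall>x. inner (T x) y = inner x s" for y
  proof -
    have "bounded_linear (\<lambda>x. inner (T x) y)"
      by (intro bounded_linear_inner_left_comp blinfun.bounded_linear_right)
    then show ?thesis by (metis riesz_representation_real)
  qed
  then obtain s where s: "\<And>x y. inner (T x) y = inner x (s y)" by metis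
  have add: "s (y + z) = s y + s z" for y z
    by (rule inner_ext) (simp add: inner_add_right flip: s)
  have scale: "s (r *\<^sub>R y) = r *\<^sub>R s y" for r y
    by (rule inner_ext) (simp flip: s)
  have bound: "norm (s y) \<le> norm y * norm T" for y
  proof (cases "s y = 0")
    case False
    \<comment> \<open>The defining relation of \<open>s\<close> is tested at
      \<open>x = s y\<close>.\<close>
    have "norm (s y) * norm (s y) = inner (T (s y)) y"
      by (simp add: s power2_norm_eq_inner flip: power2_eq_square)
    also have "\<dots> \<le> norm (T (s y)) * norm y" by (rule norm_cauchy_schwarz)
    also have "\<dots> \<le> norm T * norm (s y) * norm y" by (intro mult_right_mono norm_blinfun) simp
    finally show ?thesis using False by (simp add: mult.commute mult.left_commute)
  qed simp
  have bl: "bounded_linear s"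
    by (rule bounded_linear_intro[OF add scale bound])
  have "s (scaleC c y) = scaleC c (s y)" for c y
  proof (rule inner_ext)
    fix x
    have "inner x (s (scaleC c y)) = inner (T x) (scaleC c y)" by (rule s[symmetric])
    also have "\<dots> = inner (T (scaleC (cnj c) x)) y"
      by (simp add: cinner_scaleC_left cinner_scaleC_right bounded_ops_scaleC[OF T] flip: Re_cinner)
    also have "\<dots> = inner (scaleC (cnj c) x) (s y)" by (rule s)
    also have "\<dots> = inner x (scaleC c (s y))"
      by (simp add: cinner_scaleC_left cinner_scaleC_right flip: Re_cinner)
    finally show "inner x (s (scaleC c y)) = inner x (scaleC c (s y))" .
  qed
  then have S: "Blinfun s \<in> bounded_ops"
    by (simp add: bounded_ops_def bounded_linear_Blinfun_apply[OF bl])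
  show ?thesis
    by (intro bexI[OF _ S] allI cinner_adjointI[OF S])
      (simp add: bounded_linear_Blinfun_apply[OF bl] s)
qed

text \<open>Since \<open>adj\<close> is a definite description, the algebraic rules for adjoints
  below reduce to verifying the defining relation for a candidate.\<close>

lemma adj_unique:
  assumes "S \<in> bounded_ops" "\<And>x y. cinner (blinfun_apply T x) y = cinner x (blinfun_apply S y)"
  shows "adj T = S"
  unfolding adj_def
proof (rule the_equality)
  fix S' assume "S' \<in> bounded_ops \<and> (\<forall>x y. cinner (blinfun_apply T x) y = cinner x (blinfun_apply S' y))"
  then have "inner x (S' y) = inner x (S y)" for x y
    by (metis Re_cinner assms(2))
  then show "S' = S" by (blast intro: blinfun_eqI inner_ext)
qed (use assms in blast)

lemma
  assumes "T \<in> bounded_ops"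
  shows adj_bounded_ops: "adj T \<in> bounded_ops"
    and cinner_adj_right: "cinner x (blinfun_apply (adj T) y) = cinner (blinfun_apply T x) y"
  using ex_adjoint[OF assms] adj_unique[of _ T] by metis+

lemma cinner_adj_left:
  "T \<in> bounded_ops \<Longrightarrow> cinner (blinfun_apply (adj T) x) y = cinner x (blinfun_apply T y)"
  by (metis cinner_adj_right cinner_commute)

lemma adj_adj: "T \<in> bounded_ops \<Longrightarrow> adj (adj T) = T"
  by (rule adj_unique) (simp_all add: cinner_adj_left)

lemma adj_compose:
  "S \<in> bounded_ops \<Longrightarrow> T \<in> bounded_ops \<Longrightarrow> adj (S o\<^sub>L T) = adj T o\<^sub>L adj S"
  by (rule adj_unique) (simp_all add: bounded_ops_compose adj_bounded_ops cinner_adj_right)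

lemma adj_add: "S \<in> bounded_ops \<Longrightarrow> T \<in> bounded_ops \<Longrightarrow> adj (S + T) = adj S + adj T"
  by (rule adj_unique)
    (simp_all add: bounded_ops_add adj_bounded_ops cinner_adj_right blinfun.add_left
      cinner_add_left cinner_add_right)

lemma adj_diff: "S \<in> bounded_ops \<Longrightarrow> T \<in> bounded_ops \<Longrightarrow> adj (S - T) = adj S - adj T"
  by (rule adj_unique)
    (simp_all add: bounded_ops_diff adj_bounded_ops cinner_adj_right blinfun.diff_left
      cinner_diff_left cinner_diff_right)

section \<open>Nonnegative operators and their Cauchy-Schwarz estimates\<close>

lemma nonneg_opsI:
  assumes "P \<in> bounded_ops" "\<And>x y. inner (blinfun_apply P x) y = inner x (blinfun_apply P y)"
    and "\<And>x. 0 \<le> inner (blinfun_apply P x) x"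
  shows "P \<in> nonneg_ops"
  using assms adj_unique[OF assms(1) cinner_adjointI[OF assms(1,2)]]
  by (simp add: nonneg_ops_def Re_cinner)

lemma
  assumes "P \<in> nonneg_ops"
  shows nonneg_ops_bounded: "P \<in> bounded_ops"
    and nonneg_ops_adj: "adj P = P"
    and nonneg_ops_nonneg: "0 \<le> inner (blinfun_apply P x) x"
  using assms by (auto simp: nonneg_ops_def Re_cinner)

lemma nonneg_ops_symmetric:
  "P \<in> nonneg_ops \<Longrightarrow> cinner (blinfun_apply P x) y = cinner x (blinfun_apply P y)"
  using cinner_adj_right[of P x y] by (simp add: nonneg_ops_bounded nonneg_ops_adj)

lemma nonneg_ops_inner_symmetric:
  "P \<in> nonneg_ops \<Longrightarrow> inner (blinfun_apply P x) y = inner x (blinfun_apply P y)"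
  by (simp add: nonneg_ops_symmetric flip: Re_cinner)

lemma nonneg_ops_nonneg':
  "P \<in> nonneg_ops \<Longrightarrow> 0 \<le> inner x (blinfun_apply P x)"
  by (metis nonneg_ops_nonneg nonneg_ops_inner_symmetric)

lemma nonneg_ops_add: "P \<in> nonneg_ops \<Longrightarrow> Q \<in> nonneg_ops \<Longrightarrow> P + Q \<in> nonneg_ops"
  by (rule nonneg_opsI)
    (simp_all add: nonneg_ops_bounded bounded_ops_add blinfun.add_left inner_add_left
      inner_add_right nonneg_ops_inner_symmetric nonneg_ops_nonneg')

lemma nonneg_ops_scaleR:
  "P \<in> nonneg_ops \<Longrightarrow> 0 \<le> r \<Longrightarrow> r *\<^sub>R P \<in> nonneg_ops"
  by (rule nonneg_opsI)
    (simp_all add: nonneg_ops_bounded bounded_ops_scaleR blinfun.scaleR_left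
      nonneg_ops_inner_symmetric nonneg_ops_nonneg')

lemma adj_compose_self_nonneg:
  assumes "A \<in> bounded_ops"
  shows "adj A o\<^sub>L A \<in> nonneg_ops"
  by (rule nonneg_opsI)
    (simp_all add: assms bounded_ops_compose adj_bounded_ops cinner_adj_left cinner_adj_right
      flip: Re_cinner, simp add: Re_cinner)

text \<open>This is <P z, z> >= 0 for \<open>z = t x - u y\<close>, divided by \<open>t\<close>. The
  weighted form of the Cauchy-Schwarz inequality is preferred because it is linear in the quadratic
  terms and can be summed over indices and basis vectors before \<open>t\<close> is
  optimised.\<close>

lemma nonneg_ops_AM_GM:
  assumes P: "P \<in> nonneg_ops" and t: "0 < t"
  shows "2 * cmod (cinner (P x) y) \<le> t * inner (P x) x + inner (P y) y / t"
proof -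
  define c where "c = cinner (P x) y"
  \<comment> \<open>\<open>u\<close> is the phase of \<open>c\<close>, with the default 1 if
    \<open>c = 0\<close>; it aligns the two cross terms, which together become
    \<open>- 2 * t * cmod c\<close>.\<close>
  obtain u where u: "cmod u = 1" "c = of_real (cmod c) * u"
  proof (cases "c = 0")
    case False
    then show thesis by (intro that[of "sgn c"]) (simp_all add: sgn_eq norm_divide)
  qed (use that[of 1] in simp)
  have cy: "cinner (P y) x = cnj c"
    unfolding c_def by (metis P cinner_commute nonneg_ops_symmetric)
  have uu: "u * cnj u = 1" using u(1) by (simp add: complex_norm_square[symmetric])
  have "cnj u * c = of_real (cmod c)"
    by (metis u(2) uu mult.commute mult.left_commute mult.right_neutral)
  then have re: "Re (cnj u * c) = cmod c" by simp
  define z where "z = t *\<^sub>R x - scaleC u y"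
  have Pz: "P z = t *\<^sub>R P x - scaleC u (P y)"
    unfolding z_def by (simp add: blinfun.diff_right blinfun.scaleR_right bounded_ops_scaleC[OF nonneg_ops_bounded[OF P]])
  have "cinner (P z) z = of_real t * (of_real t * cinner (P x) x) - of_real t * (cnj u * c) - of_real t * cnj (cnj u * c)
      + u * cnj u * cinner (P y) y"
    unfolding Pz unfolding z_def
    by (simp add: cinner_diff_left cinner_diff_right cinner_scaleC_left cinner_scaleC_right
        cinner_scaleR_left cinner_scaleR_right cy algebra_simps flip: c_def)
  then have "Re (cinner (P z) z) = Re (of_real t * (of_real t * cinner (P x) x) - of_real t * (cnj u * c) - of_real t * cnj (cnj u * c)
      + cinner (P y) y)" unfolding uu by simp
  then have "inner (P z) z = t * (t * inner (P x) x) - 2 * t * cmod c + inner (P y) y"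
    using re by (simp add: Re_cinner del: complex_cnj_mult)
  with nonneg_ops_nonneg[OF P, of z] have "2 * t * cmod c \<le> t * (t * inner (P x) x) + inner (P y) y"
    by simp
  with t show ?thesis by (simp add: field_simps flip: c_def)
qed

text \<open>Take \<open>y = P x\<close> and \<open>t = norm P\<close> in
  \<open>nonneg_ops_AM_GM\<close>; the second term on the right is then at most the squared norm of
  \<open>P x\<close> and is absorbed by the left side.\<close>

lemma nonneg_ops_norm_le:
  assumes P: "P \<in> nonneg_ops"
  shows "(norm (P x))\<^sup>2 \<le> norm P * inner (P x) x"
proof (cases "norm P = 0")
  case False
  then have pos: "norm P > 0" by simp
  have "inner (P (P x)) (P x) \<le> norm (P (P x)) * norm (P x)" by (rule norm_cauchy_schwarz)
  also have "\<dots> \<le> norm P * norm (P x) * norm (P x)" by (intro mult_right_mono norm_blinfun) simp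
  finally have "inner (P (P x)) (P x) / norm P \<le> (norm (P x))\<^sup>2"
    using pos by (simp add: field_simps power2_eq_square)
  moreover have "cmod (cinner (P x) (P x)) = (norm (P x))\<^sup>2"
    by (simp add: cinner_self del: of_real_power)
  ultimately show ?thesis using nonneg_ops_AM_GM[OF P pos, of x "P x"] by simp
qed simp

section \<open>Square roots of nonnegative operators\<close>

text \<open>If \<open>Y = (X + Y\<^sup>2) / 2\<close> then \<open>(1 - Y)\<^sup>2 = 1 - X\<close>. For \<open>\<parallel>X\<parallel> \<le> 1\<close> the iterates of this fixed point
  equation converge in norm, because their increments are dominated by those of the same iteration
  for the number \<open>X = 1\<close>.\<close>

primrec sqrt_iter :: "('a::real_normed_vector \<Rightarrow>\<^sub>L 'a) \<Rightarrow> nat \<Rightarrow> 'a \<Rightarrow>\<^sub>L 'a" where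
  "sqrt_iter X 0 = 0"
| "sqrt_iter X (Suc n) = (1/2) *\<^sub>R (X + (sqrt_iter X n o\<^sub>L sqrt_iter X n))"

primrec sqrt_majorant :: "nat \<Rightarrow> real" where
  "sqrt_majorant 0 = 0"
| "sqrt_majorant (Suc n) = (1 + (sqrt_majorant n)\<^sup>2) / 2"

lemma sqrt_majorant_bounds: "0 \<le> sqrt_majorant n \<and> sqrt_majorant n \<le> 1"
  by (induction n) (simp_all add: power_le_one)

text \<open>The factors are ordered so that commutativity of \<open>S\<close> and \<open>T\<close>
  is avoided. Bounds \<open>s\<close>, \<open>t\<close> on the norms and \<open>s - t\<close> on the
  difference turn the right side into the difference of the squares of \<open>s\<close> and
  \<open>t\<close>, which is what the majorant recursion produces.\<close>

lemma blinfun_compose_diff_squares: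
  "(S o\<^sub>L S) - (T o\<^sub>L T) = (S o\<^sub>L (S - T)) + ((S - T) o\<^sub>L T)"
  by (rule blinfun_eqI) (simp add: blinfun.diff_right blinfun.diff_left blinfun.add_left)

lemma norm_sqrt_iter_diff:
  assumes X: "norm X \<le> 1"
  shows "norm (sqrt_iter X n) \<le> sqrt_majorant n"
    and "n \<le> m \<Longrightarrow> norm (sqrt_iter X m - sqrt_iter X n) \<le> sqrt_majorant m - sqrt_majorant n"
proof -
  show bound: "norm (sqrt_iter X n) \<le> sqrt_majorant n" for n
  proof (induction n)
    case (Suc n)
    have "norm (sqrt_iter X n o\<^sub>L sqrt_iter X n) \<le> norm (sqrt_iter X n) * norm (sqrt_iter X n)"
      by (rule norm_blinfun_compose)
    also have "\<dots> \<le> (sqrt_majorant n)\<^sup>2"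
      unfolding power2_eq_square using Suc sqrt_majorant_bounds[of n] by (intro mult_mono) auto
    finally have "norm (X + (sqrt_iter X n o\<^sub>L sqrt_iter X n)) \<le> 1 + (sqrt_majorant n)\<^sup>2"
      by (intro norm_triangle_le add_mono X)
    then show ?case by simp
  qed simp
  show "n \<le> m \<Longrightarrow> norm (sqrt_iter X m - sqrt_iter X n) \<le> sqrt_majorant m - sqrt_majorant n"
  proof (induction n arbitrary: m)
    case 0
    then show ?case using bound[of m] by simp
  next
    case (Suc n)
    \<comment> \<open>As \<open>m\<close> is at least \<open>Suc n\<close>, it is itself a
      successor, so both iterates can be unfolded once.\<close>
    then obtain k where m: "m = Suc k" "n \<le> k" by (metis Suc_le_D Suc_le_mono)
    let ?S = "sqrt_iter X k" and ?T = "sqrt_iter X n"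
    let ?s = "sqrt_majorant k" and ?t = "sqrt_majorant n"
    have d: "norm (?S - ?T) \<le> ?s - ?t" by (rule Suc.IH[OF m(2)])
    have "norm (?S o\<^sub>L (?S - ?T)) \<le> norm ?S * norm (?S - ?T)"
      by (rule norm_blinfun_compose)
    also have "\<dots> \<le> ?s * (?s - ?t)"
      using bound[of k] d sqrt_majorant_bounds[of k] by (intro mult_mono) auto
    finally have 1: "norm (?S o\<^sub>L (?S - ?T)) \<le> ?s * (?s - ?t)" .
    have "norm ((?S - ?T) o\<^sub>L ?T) \<le> norm (?S - ?T) * norm ?T"
      by (rule norm_blinfun_compose)
    also have "\<dots> \<le> (?s - ?t) * ?t"
      using bound[of n] d order_trans[OF norm_ge_zero d] by (intro mult_mono) auto
    finally have 2: "norm ((?S - ?T) o\<^sub>L ?T) \<le> (?s - ?t) * ?t" .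
    have "norm ((?S o\<^sub>L ?S) - (?T o\<^sub>L ?T)) \<le> ?s * (?s - ?t) + (?s - ?t) * ?t"
      unfolding blinfun_compose_diff_squares by (rule norm_triangle_le[OF add_mono[OF 1 2]])
    also have "\<dots> = ?s\<^sup>2 - ?t\<^sup>2" by (simp add: power2_eq_square algebra_simps)
    finally have le: "norm ((?S o\<^sub>L ?S) - (?T o\<^sub>L ?T)) \<le> ?s\<^sup>2 - ?t\<^sup>2" .
    have "sqrt_iter X m - sqrt_iter X (Suc n) = (1/2) *\<^sub>R ((?S o\<^sub>L ?S) - (?T o\<^sub>L ?T))"
      by (simp add: m scaleR_diff_right scaleR_add_right)
    then have "norm (sqrt_iter X m - sqrt_iter X (Suc n)) = norm ((?S o\<^sub>L ?S) - (?T o\<^sub>L ?T)) / 2"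
      by simp
    with le show ?case by (simp add: m field_simps)
  qed
qed

lemma convergent_sqrt_iter:
  fixes X :: "'a::banach \<Rightarrow>\<^sub>L 'a"
  assumes X: "norm X \<le> 1"
  shows "convergent (sqrt_iter X)"
proof -
  \<comment> \<open>Monotonicity is read off the increment estimate for the operator 0: increments
    of the majorant dominate a norm, hence are nonnegative.\<close>
  have "incseq sqrt_majorant"
    by (rule monoI) (use norm_sqrt_iter_diff(2)[of "0 :: 'a \<Rightarrow>\<^sub>L 'a"] order_trans[OF norm_ge_zero] in fastforce)
  then have "convergent sqrt_majorant"
    by (intro Bseq_mono_convergent BseqI'[where K = 1]) 
      (use sqrt_majorant_bounds in \<open>auto simp: incseq_def\<close>)
  then have C: "Cauchy sqrt_majorant" by (rule convergent_Cauchy)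
  have "Cauchy (sqrt_iter X)"
  proof (rule metric_CauchyI)
    fix e :: real assume "e > 0"
    then obtain M where M: "\<And>m n. m \<ge> M \<Longrightarrow> n \<ge> M \<Longrightarrow> dist (sqrt_majorant m) (sqrt_majorant n) < e"
      using metric_CauchyD[OF C] by blast
    have "dist (sqrt_iter X m) (sqrt_iter X n) < e" if "m \<ge> M" "n \<ge> M" "n \<le> m" for m n
      using norm_sqrt_iter_diff(2)[OF X that(3)] M[OF that(1,2)] by (simp add: dist_norm)
    then have "dist (sqrt_iter X m) (sqrt_iter X n) < e" if "m \<ge> M" "n \<ge> M" for m n
      using that by (metis dist_commute nle_le)
    then show "\<exists>M. \<forall>m\<ge>M. \<forall>n\<ge>M. dist (sqrt_iter X m) (sqrt_iter X n) < e" by blast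
  qed
  then show ?thesis by (rule Cauchy_convergent)
qed

lemma symmetric_lim:
  assumes X: "X \<longlonglongrightarrow> Y"
    and symm: "\<And>n x y. inner (blinfun_apply (X n) x) y = inner x (blinfun_apply (X n) y)"
  shows "inner (blinfun_apply Y x) y = inner x (blinfun_apply Y y)"
proof (rule LIMSEQ_unique)
  show "(\<lambda>n. inner (X n x) y) \<longlonglongrightarrow> inner (Y x) y"
    by (intro tendsto_intros X)
  show "(\<lambda>n. inner (X n x) y) \<longlonglongrightarrow> inner x (Y y)"
    unfolding symm by (intro tendsto_intros X)
qed

text \<open>Scale so that \<open>c *\<^sub>R T\<close> has norm 1 and run the iteration for
  \<open>X = 1 - c T\<close>, a contraction. For its limit \<open>Y\<close>, the operator
  \<open>S = 1 - Y\<close> squares to \<open>1 - X = c T\<close>; it is nonnegative because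
  \<open>norm Y\<close> is at most 1. Scaling back gives the root of \<open>T\<close>.\<close>

lemma nonneg_ops_ex_sqrt:
  assumes T: "T \<in> nonneg_ops"
  shows "\<exists>R\<in>nonneg_ops. R o\<^sub>L R = T"
proof (cases "T = 0")
  case True
  then show ?thesis
    using T by (intro bexI[of _ T]) simp_all
next
  case False
  define c where "c = inverse (norm T)"
  have c: "c > 0" "c * norm T = 1" using False by (simp_all add: c_def)
  define X where "X = id_blinfun - c *\<^sub>R T"
  have X_bounded: "X \<in> bounded_ops"
    unfolding X_def by (intro bounded_ops_diff bounded_ops_id bounded_ops_scaleR nonneg_ops_bounded T)
  have X_symmetric: "inner (X x) y = inner x (X y)" for x y
    by (simp add: X_def blinfun.diff_left blinfun.scaleR_left inner_diff_left inner_diff_right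
        nonneg_ops_inner_symmetric[OF T])
  \<comment> \<open>In the expansion of the squared norm of \<open>X x\<close>, the term in the
    squared norm of \<open>T x\<close> is at most \<open>c * inner (T x) x\<close> by
    \<open>nonneg_ops_norm_le\<close>, which is half of what the cross term subtracts.\<close>
  have X_norm: "norm X \<le> 1"
  proof (rule norm_blinfun_bound)
    fix x
    have "(norm (X x))\<^sup>2 = (norm x)\<^sup>2 - 2 * c * inner (T x) x + c\<^sup>2 * (norm (T x))\<^sup>2"
      unfolding power2_norm_eq_inner
      by (simp add: X_def blinfun.diff_left blinfun.scaleR_left
          inner_diff_left inner_diff_right inner_commute power2_eq_square algebra_simps)
    also have "\<dots> \<le> (norm x)\<^sup>2 - 2 * c * inner (T x) x + c\<^sup>2 * (norm T * inner (T x) x)"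
      by (intro add_left_mono mult_left_mono nonneg_ops_norm_le T) simp
    also have "c\<^sup>2 * (norm T * inner (T x) x) = c * (c * norm T) * inner (T x) x"
      by (simp add: power2_eq_square)
    also have "(norm x)\<^sup>2 - 2 * c * inner (T x) x + c * (c * norm T) * inner (T x) x \<le> (norm x)\<^sup>2"
      using c nonneg_ops_nonneg[OF T, of x] by simp
    finally show "norm (X x) \<le> 1 * norm x" using power2_le_imp_le[of "norm (X x)" "norm x"] by simp
  qed simp
  obtain Y where Y: "sqrt_iter X \<longlonglongrightarrow> Y"
    using convergent_sqrt_iter[OF X_norm] by (auto simp: convergent_def)
  have iter_bounded: "sqrt_iter X n \<in> bounded_ops" for n
    by (induction n) (auto intro!: bounded_ops_zero bounded_ops_scaleR bounded_ops_add
        bounded_ops_compose X_bounded)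
  have iter_symmetric: "inner (sqrt_iter X n x) y = inner x (sqrt_iter X n y)" for n x y
    by (induction n arbitrary: x y)
      (simp_all add: X_symmetric blinfun.add_left blinfun.scaleR_left inner_add_left inner_add_right)
  have iter_norm: "norm (sqrt_iter X n) \<le> 1" for n
    using norm_sqrt_iter_diff(1)[OF X_norm, of n] sqrt_majorant_bounds[of n] by simp
  have Y_bounded: "Y \<in> bounded_ops" by (rule bounded_ops_lim[OF iter_bounded Y])
  have Y_symmetric: "inner (Y x) y = inner x (Y y)" for x y
    by (rule symmetric_lim[OF Y iter_symmetric])
  have Y_norm: "norm Y \<le> 1"
    by (rule LIMSEQ_le_const2[OF tendsto_norm[OF Y]]) (use iter_norm in blast)
  have "(\<lambda>n. sqrt_iter X (Suc n)) \<longlonglongrightarrow> (1/2) *\<^sub>R (X + (Y o\<^sub>L Y))"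
    unfolding sqrt_iter.simps by (intro tendsto_intros Y)
  with LIMSEQ_Suc[OF Y] have "Y = (1/2) *\<^sub>R (X + (Y o\<^sub>L Y))" by (rule LIMSEQ_unique)
  then have "2 *\<^sub>R Y = 2 *\<^sub>R (1/2) *\<^sub>R (X + (Y o\<^sub>L Y))" by (rule arg_cong)
  then have YY: "2 *\<^sub>R Y = X + (Y o\<^sub>L Y)" by simp
  define S where "S = id_blinfun - Y"
  have S: "S \<in> nonneg_ops"
  proof (rule nonneg_opsI)
    show "S \<in> bounded_ops"
      unfolding S_def by (intro bounded_ops_diff bounded_ops_id Y_bounded)
    show "inner (S x) y = inner x (S y)" for x y
      by (simp add: S_def blinfun.diff_left inner_diff_left inner_diff_right Y_symmetric)
    fix x
    have "inner (Y x) x \<le> norm (Y x) * norm x" by (rule norm_cauchy_schwarz)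
    also have "\<dots> \<le> norm Y * norm x * norm x" by (intro mult_right_mono norm_blinfun) simp
    also have "\<dots> \<le> 1 * norm x * norm x" by (intro mult_right_mono Y_norm) simp_all
    also have "\<dots> = inner x x" by (simp add: power2_norm_eq_inner flip: power2_eq_square)
    finally show "0 \<le> inner (S x) x" by (simp add: S_def blinfun.diff_left inner_diff_left)
  qed
  have "S o\<^sub>L S = id_blinfun - (2 *\<^sub>R Y - (Y o\<^sub>L Y))"
    by (rule blinfun_eqI)
      (simp add: S_def blinfun.diff_left blinfun.diff_right blinfun.scaleR_left blinfun.add_left scaleR_2)
  also have "\<dots> = c *\<^sub>R T" by (simp add: YY X_def)
  finally have SS: "S o\<^sub>L S = c *\<^sub>R T" .
  define R where "R = sqrt (norm T) *\<^sub>R S"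
  have "R \<in> nonneg_ops" unfolding R_def by (intro nonneg_ops_scaleR S) simp
  moreover have "R o\<^sub>L R = T"
  proof -
    have "R o\<^sub>L R = norm T *\<^sub>R (S o\<^sub>L S)"
      by (rule blinfun_eqI) (simp add: R_def blinfun.scaleR_left blinfun.scaleR_right flip: scaleR_scaleR, simp)
    then show ?thesis using c by (simp add: SS mult.commute)
  qed
  ultimately show ?thesis by blast
qed

text \<open>The choice in \<open>op_sqrt\<close> has the required square as soon as a nonnegative
  root of \<open>adj A o\<^sub>L A\<close> exists. From here on the moduli in
  \<open>sigma_tr\<close> can be replaced by products with the adjoint.\<close>

lemma op_abs_compose_self:
  assumes "A \<in> bounded_ops"
  shows "op_abs A o\<^sub>L op_abs A = adj A o\<^sub>L A"
  unfolding op_abs_def op_sqrt_def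
  using someI_ex[of "\<lambda>R. R \<in> nonneg_ops \<and> R o\<^sub>L R = adj A o\<^sub>L A"]
    nonneg_ops_ex_sqrt[OF adj_compose_self_nonneg[OF assms]] by blast

section \<open>Parseval identity and Hilbert-Schmidt operators\<close>

text \<open>Completing the square coefficientwise. Arbitrary coefficients \<open>a\<close> allow two
  uses: \<open>a e = cinner x e\<close> gives Bessel's inequality, and dropping the last sum shows
  that no other combination approximates better.\<close>

lemma norm_diff_orthonormal_sum:
  fixes x :: "'a::complex_hilbert"
  assumes F: "finite F" and on: "\<And>e f. e \<in> F \<Longrightarrow> f \<in> F \<Longrightarrow> cinner e f = (if e = f then 1 else 0)"
  shows "(norm (x - (\<Sum>e\<in>F. scaleC (a e) e)))\<^sup>2 =
    (norm x)\<^sup>2 - (\<Sum>e\<in>F. (cmod (cinner x e))\<^sup>2) + (\<Sum>e\<in>F. (cmod (cinner x e - a e))\<^sup>2)"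
proof -
  define s where "s = (\<Sum>e\<in>F. scaleC (a e) e)"
  have se: "cinner s e = a e" if "e \<in> F" for e
  proof -
    have "cinner s e = (\<Sum>f\<in>F. a f * (if f = e then 1 else 0))"
      unfolding s_def cinner_sum_left cinner_scaleC_left
      by (intro sum.cong) (simp_all add: on that)
    also have "\<dots> = a e" using F that by (simp add: if_distrib cong: if_cong)
    finally show ?thesis .
  qed
  have ss: "cinner y s = (\<Sum>e\<in>F. cnj (a e) * cinner y e)" for y
    unfolding s_def by (simp add: cinner_sum_right cinner_scaleC_right)
  have "cinner (x - s) (x - s) = cinner x x - cinner x s - cnj (cinner x s) + cinner s s"
    by (simp add: cinner_diff_left cinner_diff_right flip: cinner_commute)
  also have "\<dots> = cinner x x + (\<Sum>e\<in>F. cnj (a e) * a e - cnj (a e) * cinner x e - cnj (cnj (a e) * cinner x e))"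
    by (simp add: ss se sum_subtractf)
  also have "(\<Sum>e\<in>F. cnj (a e) * a e - cnj (a e) * cinner x e - cnj (cnj (a e) * cinner x e))
      = (\<Sum>e\<in>F. of_real ((cmod (cinner x e - a e))\<^sup>2) - of_real ((cmod (cinner x e))\<^sup>2))"
    unfolding complex_norm_square by (intro sum.cong) (simp_all add: algebra_simps)
  finally have "complex_of_real ((norm (x - s))\<^sup>2) =
      of_real ((norm x)\<^sup>2 + (\<Sum>e\<in>F. (cmod (cinner x e - a e))\<^sup>2 - (cmod (cinner x e))\<^sup>2))"
    unfolding cinner_self by simp
  then show ?thesis unfolding of_real_eq_iff s_def by (simp add: sum_subtractf)
qed

text \<open>By density some finite combination over \<open>t\<close> is within
  \<open>sqrt \<epsilon>\<close> of \<open>x\<close>. For every finite \<open>F\<close> containing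
  \<open>t\<close> the best approximation is at least as good, so the partial sum over
  \<open>F\<close> misses the squared norm by less than \<open>\<epsilon>\<close>.\<close>

lemma parseval:
  fixes x :: "'a::complex_hilbert"
  assumes E: "is_onb E"
  shows "((\<lambda>e. (cmod (cinner x e))\<^sup>2) has_sum (norm x)\<^sup>2) E"
  unfolding has_sum_def
proof (rule tendstoI)
  fix \<epsilon> :: real assume \<epsilon>: "\<epsilon> > 0"
  have on: "cinner e f = (if e = f then 1 else 0)" if "e \<in> E" "f \<in> E" for e f
    using E that by (simp add: is_onb_def)
  have "x \<in> closure (complex_vector.span E)" using E by (simp add: is_onb_def)
  then obtain s where s: "s \<in> complex_vector.span E" "dist s x < sqrt \<epsilon>"
    using \<epsilon> by (metis closure_approachable real_sqrt_gt_zero)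
  then obtain t r where t: "finite t" "t \<subseteq> E" "s = (\<Sum>a\<in>t. scaleC (r a) a)"
    unfolding complex_vector.span_explicit by blast
  have "dist (\<Sum>e\<in>F. (cmod (cinner x e))\<^sup>2) ((norm x)\<^sup>2) < \<epsilon>" if F: "finite F" "t \<subseteq> F" "F \<subseteq> E" for F
  proof -
    note eq = norm_diff_orthonormal_sum[OF F(1) on, OF subsetD[OF F(3)] subsetD[OF F(3)]]
    \<comment> \<open>The coefficients are extended by 0 from \<open>t\<close> to \<open>F\<close>,
      making \<open>s\<close> a competitor over \<open>F\<close>.\<close>
    define a where "a e = (if e \<in> t then r e else 0)" for e
    have "s = (\<Sum>e\<in>F. scaleC (a e) e)"
      unfolding t(3) a_def using F t by (intro sum.mono_neutral_cong_left) auto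
    then have "(norm (x - s))\<^sup>2 \<ge> (norm x)\<^sup>2 - (\<Sum>e\<in>F. (cmod (cinner x e))\<^sup>2)"
      by (simp add: eq sum_nonneg)
    moreover have "(norm (x - s))\<^sup>2 < (sqrt \<epsilon>)\<^sup>2"
      using s(2) by (intro power_strict_mono) (simp_all add: dist_norm norm_minus_commute)
    \<comment> \<open>Bessel's inequality, from the coefficients that make the last sum of
      \<open>eq\<close> vanish.\<close>
    moreover have "0 \<le> (norm x)\<^sup>2 - (\<Sum>e\<in>F. (cmod (cinner x e))\<^sup>2)"
      using eq[of x "cinner x"] zero_le_power2[of "norm (x - (\<Sum>e\<in>F. scaleC (cinner x e) e))"] by simp
    ultimately show ?thesis using \<epsilon> by (simp add: dist_real_def)
  qed
  then show "\<forall>\<^sub>F F in finite_subsets_at_top E. dist (\<Sum>e\<in>F. (cmod (cinner x e))\<^sup>2) ((norm x)\<^sup>2) < \<epsilon>"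
    unfolding eventually_finite_subsets_at_top using t by blast
qed

text \<open>The double family of squared moduli of \<open>cinner (A e) f\<close> is nonnegative, so
  it may be summed by rows or by columns; Parseval in \<open>F\<close> evaluates the rows and
  Parseval in \<open>E\<close> the columns. Allowing two bases is what yields basis
  independence.\<close>

lemma adjoint_square_has_sum:
  assumes A: "A \<in> bounded_ops" and E: "is_onb E" and F: "is_onb F"
    and S: "((\<lambda>e. (norm (blinfun_apply A e))\<^sup>2) has_sum S) E"
  shows "((\<lambda>f. (norm (blinfun_apply (adj A) f))\<^sup>2) has_sum S) F"
proof -
  let ?g = "\<lambda>(e, f). (cmod (cinner (A e) f))\<^sup>2"
  have rows: "((\<lambda>f. ?g (e, f)) has_sum (norm (A e))\<^sup>2) F" for e
    using parseval[OF F, of "A e"] by simp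
  have "?g summable_on E \<times> F"
    by (rule summable_on_SigmaI[OF rows]) (use S in \<open>auto dest: has_sum_imp_summable\<close>)
  then have "(?g has_sum S) (E \<times> F)" by (rule has_sum_SigmaI[OF rows S])
  then have "((\<lambda>(f, e). ?g (e, f)) has_sum S) (F \<times> E)" by (rule has_sum_swap[THEN iffD1])
  moreover have "((\<lambda>e. (\<lambda>(f, e). ?g (e, f)) (f, e)) has_sum (norm (adj A f))\<^sup>2) E" for f
  proof -
    have "cmod (cinner (adj A f) e) = cmod (cinner (A e) f)" for e
      by (metis cinner_adj_left[OF A] cinner_commute complex_mod_cnj)
    then show ?thesis using parseval[OF E, of "adj A f"] by simp
  qed
  ultimately show ?thesis by (rule has_sum_SigmaD)
qed

section \<open>Closure properties and the inner product of Hilbert-Schmidt operators\<close>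

lemma hilbert_schmidt_bounded: "A \<in> hilbert_schmidt \<Longrightarrow> A \<in> bounded_ops"
  by (simp add: hilbert_schmidt_def)

lemma hilbert_schmidtI:
  "A \<in> bounded_ops \<Longrightarrow> is_onb E \<Longrightarrow> (\<lambda>e. (norm (blinfun_apply A e))\<^sup>2) summable_on E \<Longrightarrow> A \<in> hilbert_schmidt"
  by (auto simp: hilbert_schmidt_def)

lemma hilbert_schmidt_adj_summable:
  assumes "A \<in> hilbert_schmidt" "is_onb F"
  shows "(\<lambda>f. (norm (blinfun_apply (adj A) f))\<^sup>2) summable_on F"
  using assms adjoint_square_has_sum[of A _ F]
  by (fastforce simp: hilbert_schmidt_def summable_on_def)

lemma hilbert_schmidt_adj:
  assumes A: "A \<in> hilbert_schmidt"
  shows "adj A \<in> hilbert_schmidt"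
proof -
  obtain E :: "'a set" where "is_onb E" using A by (auto simp: hilbert_schmidt_def)
  then show ?thesis
    by (metis A adj_bounded_ops hilbert_schmidtI hilbert_schmidt_adj_summable hilbert_schmidt_bounded)
qed

text \<open>Passing to the adjoint twice carries summability from the basis supplied by the
  definition to an arbitrary one.\<close>

lemma hilbert_schmidt_summable:
  assumes "A \<in> hilbert_schmidt" "is_onb E"
  shows "(\<lambda>e. (norm (blinfun_apply A e))\<^sup>2) summable_on E"
  using hilbert_schmidt_adj_summable[OF hilbert_schmidt_adj] adj_adj hilbert_schmidt_bounded assms
  by metis

lemma hilbert_schmidt_compose_left:
  assumes T: "T \<in> bounded_ops" and A: "A \<in> hilbert_schmidt"
  shows "T o\<^sub>L A \<in> hilbert_schmidt"
proof -
  obtain E :: "'a set" where E: "is_onb E" using A by (auto simp: hilbert_schmidt_def)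
  have "(\<lambda>e. (norm T)\<^sup>2 * (norm (A e))\<^sup>2) summable_on E"
    by (intro summable_on_cmult_right hilbert_schmidt_summable A E)
  then have "(\<lambda>e. (norm ((T o\<^sub>L A) e))\<^sup>2) summable_on E"
  proof (rule summable_on_comparison_test)
    fix e
    show "(norm ((T o\<^sub>L A) e))\<^sup>2 \<le> (norm T)\<^sup>2 * (norm (A e))\<^sup>2"
      using power_mono[OF norm_blinfun[of T "A e"], of 2] by (simp add: power_mult_distrib)
  qed simp
  then show ?thesis
    by (rule hilbert_schmidtI[OF bounded_ops_compose[OF T hilbert_schmidt_bounded[OF A]] E])
qed

text \<open>Taking adjoints turns right multiplication by \<open>T\<close> into left multiplication
  by \<open>adj T\<close>.\<close>

lemma hilbert_schmidt_compose_right: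
  assumes T: "T \<in> bounded_ops" and A: "A \<in> hilbert_schmidt"
  shows "A o\<^sub>L T \<in> hilbert_schmidt"
proof -
  have "adj (adj T o\<^sub>L adj A) \<in> hilbert_schmidt"
    by (intro hilbert_schmidt_adj hilbert_schmidt_compose_left adj_bounded_ops T A)
  then show ?thesis
    by (simp add: adj_compose adj_adj adj_bounded_ops T A hilbert_schmidt_bounded)
qed

lemma norm_add_diff_square_le:
  fixes x y :: "'a::real_inner"
  shows "(norm (x + y))\<^sup>2 \<le> 2 * ((norm x)\<^sup>2 + (norm y)\<^sup>2)"
    and "(norm (x - y))\<^sup>2 \<le> 2 * ((norm x)\<^sup>2 + (norm y)\<^sup>2)"
  using zero_le_power2[of "norm (x + y)"] zero_le_power2[of "norm (x - y)"]
  unfolding power2_norm_eq_inner by (simp_all add: algebra_simps inner_commute)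

lemma hilbert_schmidt_add_diff:
  assumes A: "A \<in> hilbert_schmidt" and B: "B \<in> hilbert_schmidt"
  shows "A + B \<in> hilbert_schmidt" and "A - B \<in> hilbert_schmidt"
proof -
  obtain E :: "'a set" where E: "is_onb E" using A by (auto simp: hilbert_schmidt_def)
  have s: "(\<lambda>e. 2 * ((norm (A e))\<^sup>2 + (norm (B e))\<^sup>2)) summable_on E"
    by (intro summable_on_cmult_right summable_on_add hilbert_schmidt_summable A B E)
  have "(\<lambda>e. (norm ((A + B) e))\<^sup>2) summable_on E" "(\<lambda>e. (norm ((A - B) e))\<^sup>2) summable_on E"
    by (rule summable_on_comparison_test[OF s];
        simp add: blinfun.add_left blinfun.diff_left norm_add_diff_square_le[simplified])+
  then show "A + B \<in> hilbert_schmidt" "A - B \<in> hilbert_schmidt"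
    using A B by (blast intro: hilbert_schmidtI[OF _ E] bounded_ops_add bounded_ops_diff
        dest: hilbert_schmidt_bounded)+
qed

text \<open>Polarization expresses both series through squared norms for \<open>A + B\<close> and
  \<open>A - B\<close>, and \<open>adjoint_square_has_sum\<close> says that those sums survive
  passing to the adjoint.\<close>

lemma hilbert_schmidt_inner_has_sum:
  assumes A: "A \<in> hilbert_schmidt" and B: "B \<in> hilbert_schmidt" and E: "is_onb E"
  shows "\<exists>s. ((\<lambda>e. inner (blinfun_apply A e) (blinfun_apply B e)) has_sum s) E \<and>
    ((\<lambda>e. inner (blinfun_apply (adj A) e) (blinfun_apply (adj B) e)) has_sum s) E"
proof -
  note bdd = hilbert_schmidt_bounded[OF A] hilbert_schmidt_bounded[OF B]
  have polarization: "inner x y = ((norm (x + y))\<^sup>2 - (norm (x - y))\<^sup>2) / 4" for x y :: 'a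
    unfolding power2_norm_eq_inner by (simp add: algebra_simps inner_commute)
  obtain p where p: "((\<lambda>e. (norm ((A + B) e))\<^sup>2) has_sum p) E"
    using hilbert_schmidt_summable[OF hilbert_schmidt_add_diff(1)[OF A B] E] summable_on_def by blast
  obtain m where m: "((\<lambda>e. (norm ((A - B) e))\<^sup>2) has_sum m) E"
    using hilbert_schmidt_summable[OF hilbert_schmidt_add_diff(2)[OF A B] E] summable_on_def by blast
  have p': "((\<lambda>e. (norm ((adj A + adj B) e))\<^sup>2) has_sum p) E"
    using adjoint_square_has_sum[OF bounded_ops_add[OF bdd] E E p] by (simp add: adj_add bdd)
  have m': "((\<lambda>e. (norm ((adj A - adj B) e))\<^sup>2) has_sum m) E"
    using adjoint_square_has_sum[OF bounded_ops_diff[OF bdd] E E m] by (simp add: adj_diff bdd)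
  have diff: "((\<lambda>e. (f e - g e) / 4) has_sum ((s - t) / 4)) E"
    if "(f has_sum s) E" "(g has_sum t) E" for f g :: "'a \<Rightarrow> real" and s t
    using has_sum_divide_const[OF has_sum_add[OF that(1) has_sum_uminusI[OF that(2)]], of 4] by simp
  show ?thesis
    unfolding polarization using diff[OF p m] diff[OF p' m']
    by (auto simp: blinfun.add_left blinfun.diff_left)
qed

text \<open>The real parts are the previous lemma for \<open>A\<close> and \<open>B\<close>; the
  imaginary parts are the same lemma for \<open>A\<close> and \<open>J o\<^sub>L B\<close>, where
  \<open>J\<close> is multiplication by \<open>\<i>\<close> as an operator.\<close>

lemma hilbert_schmidt_cinner_has_sum:
  assumes A: "A \<in> hilbert_schmidt" and B: "B \<in> hilbert_schmidt" and E: "is_onb E"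
  shows "\<exists>s. ((\<lambda>e. cinner (blinfun_apply A e) (blinfun_apply B e)) has_sum s) E \<and>
    ((\<lambda>e. cinner (blinfun_apply (adj B) e) (blinfun_apply (adj A) e)) has_sum s) E"
proof -
  define J :: "'a \<Rightarrow>\<^sub>L 'a" where "J = Blinfun (scaleC \<i>)"
  have J: "J x = scaleC \<i> x" for x
    unfolding J_def by (simp add: bounded_linear_Blinfun_apply bounded_linear_scaleC)
  have J_bounded: "J \<in> bounded_ops"
    by (simp add: bounded_ops_def J scaleC_scaleC mult.commute)
  have "(-1) *\<^sub>R J \<in> bounded_ops" by (rule bounded_ops_scaleR[OF J_bounded])
  then have J_adj: "adj J = - J"
    by (intro adj_unique)
      (simp_all add: J blinfun.minus_left cinner_minus_right cinner_scaleC_left cinner_scaleC_right)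
  note bdd = hilbert_schmidt_bounded[OF A] hilbert_schmidt_bounded[OF B]
  have combine: "((\<lambda>e. cinner (f e) (g e)) has_sum Complex r q) E"
    if "((\<lambda>e. inner (f e) (g e)) has_sum r) E" "((\<lambda>e. inner (f e) (scaleC \<i> (g e))) has_sum q) E"
    for f g :: "'a \<Rightarrow> 'a" and r q
  proof -
    have "((\<lambda>e. complex_of_real (inner (f e) (g e)) + \<i> * of_real (inner (f e) (scaleC \<i> (g e))))
      has_sum (of_real r + \<i> * of_real q)) E"
      by (intro has_sum_add has_sum_cmult_right has_sum_of_real that)
    moreover have "of_real (inner x y) + \<i> * of_real (inner x (scaleC \<i> y)) = cinner x y" for x y :: 'a
      by (simp add: complex_eq_iff Re_cinner Im_cinner)
    ultimately show ?thesis by (simp add: Complex_eq)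
  qed
  obtain r where r: "((\<lambda>e. inner (A e) (B e)) has_sum r) E"
      "((\<lambda>e. inner (adj A e) (adj B e)) has_sum r) E"
    using hilbert_schmidt_inner_has_sum[OF A B E] by blast
  obtain q where q: "((\<lambda>e. inner (A e) ((J o\<^sub>L B) e)) has_sum q) E"
      "((\<lambda>e. inner (adj A e) (adj (J o\<^sub>L B) e)) has_sum q) E"
    using hilbert_schmidt_inner_has_sum[OF A hilbert_schmidt_compose_left[OF J_bounded B] E] by blast
  have "adj (J o\<^sub>L B) e = - scaleC \<i> (adj B e)" for e
    using adj_bounded_ops[OF bdd(2)]
    by (simp add: adj_compose J_bounded bdd J_adj blinfun.minus_left blinfun.minus_right J bounded_ops_scaleC)
  \<comment> \<open>Skewness of \<open>\<i>\<close> moves it to the other argument; this is why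
    \<open>A\<close> and \<open>B\<close> change places on the adjoint side.\<close>
  then have "inner (adj A e) (adj (J o\<^sub>L B) e) = inner (adj B e) (scaleC \<i> (adj A e))" for e
    using inner_scaleC_i[of "adj B e" "adj A e"] by (simp add: inner_commute)
  then have "((\<lambda>e. inner (adj B e) (scaleC \<i> (adj A e))) has_sum q) E"
    using q(2) by simp
  moreover have "((\<lambda>e. inner (A e) (scaleC \<i> (B e))) has_sum q) E"
    using q(1) by (simp add: J)
  moreover have "((\<lambda>e. inner (adj B e) (adj A e)) has_sum r) E"
    using r(2) by (simp add: inner_commute)
  ultimately show ?thesis using combine r(1) by blast
qed

text \<open>\<open>tr\<close> sums over a chosen basis. A basis exists because membership in
  \<open>hilbert_schmidt\<close> carries one as a witness.\<close>

lemma is_onb_some: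
  assumes "(A :: 'a::complex_hilbert \<Rightarrow>\<^sub>L 'a) \<in> hilbert_schmidt"
  shows "is_onb (SOME E :: 'a set. is_onb E)"
  using assms by (auto simp: hilbert_schmidt_def intro: someI)

text \<open>Cyclicity of the trace, \<open>tr (P A\<^sup>* B) = tr (B P A\<^sup>*)\<close>: the second sum is a form in the
  vectors \<open>A\<^sup>* e\<close>, \<open>B\<^sup>* e\<close> that is termwise nonnegative when \<open>A = B\<close>.\<close>

lemma hilbert_schmidt_trace_cyclic:
  assumes P: "P \<in> nonneg_ops" and A: "A \<in> hilbert_schmidt" and B: "B \<in> hilbert_schmidt"
    and E: "is_onb E"
  shows "\<exists>s. ((\<lambda>e. cinner (blinfun_apply (P o\<^sub>L (adj A o\<^sub>L B)) e) e) has_sum s) E \<and>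
    ((\<lambda>e. cinner (blinfun_apply P (blinfun_apply (adj A) e)) (blinfun_apply (adj B) e)) has_sum s) E"
proof -
  note bdd = hilbert_schmidt_bounded[OF A] hilbert_schmidt_bounded[OF B] nonneg_ops_bounded[OF P]
  \<comment> \<open>The diagonal terms are rewritten as inner products of the Hilbert-Schmidt
    operators \<open>B\<close> and \<open>A o\<^sub>L P\<close>, to which the exchange of operators
    and adjoints applies.\<close>
  have "cinner ((P o\<^sub>L (adj A o\<^sub>L B)) e) e = cinner (B e) ((A o\<^sub>L P) e)" for e
    by (simp add: nonneg_ops_symmetric[OF P] cinner_adj_left bdd)
  moreover have "adj (A o\<^sub>L P) e = P (adj A e)" for e
    by (simp add: adj_compose bdd nonneg_ops_adj[OF P])
  ultimately show ?thesis
    using hilbert_schmidt_cinner_has_sum[OF B hilbert_schmidt_compose_right[OF bdd(3) A] E] by simp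
qed

lemma has_sum_finite_sum:
  fixes f :: "'k \<Rightarrow> 'b \<Rightarrow> 'c::topological_comm_monoid_add"
  assumes "\<forall>k\<in>K. (f k has_sum s k) A"
  shows "((\<lambda>x. \<Sum>k\<in>K. f k x) has_sum (\<Sum>k\<in>K. s k)) A"
  using assms
  by (induction K rule: infinite_finite_induct) (auto intro!: has_sum_add)

section \<open>The trace form\<close>

definition trace_form ::
  "nat \<Rightarrow> (nat \<Rightarrow> 'a::complex_hilbert \<Rightarrow>\<^sub>L 'a) \<Rightarrow> (nat \<Rightarrow> 'a \<Rightarrow>\<^sub>L 'a) \<Rightarrow> (nat \<Rightarrow> 'a \<Rightarrow>\<^sub>L 'a) \<Rightarrow> complex"
  where "trace_form n P A B = tr (\<Sum>k=1..n. P k o\<^sub>L (adj (A k) o\<^sub>L B k))"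

text \<open>This replaces the trace by a series whose terms are themselves hermitian forms, so that
  the properties of \<open>trace_form\<close> below can be checked term by term.\<close>

lemma trace_form_has_sum:
  fixes A :: "nat \<Rightarrow> 'a::complex_hilbert \<Rightarrow>\<^sub>L 'a"
  assumes A: "\<forall>k\<in>{1..n}. A k \<in> hilbert_schmidt"
    and B: "\<forall>k\<in>{1..n}. B k \<in> hilbert_schmidt"
    and E: "is_onb (SOME E :: 'a set. is_onb E)"
    and P: "P \<in> nonneg_tuples n"
  shows "((\<lambda>e. \<Sum>k=1..n. cinner (P k (adj (A k) e)) (adj (B k) e)) has_sum trace_form n P A B)
    (SOME E. is_onb E)"
proof -
  let ?E = "SOME E :: 'a set. is_onb E"
  have "\<forall>k\<in>{1..n}. \<exists>s. ((\<lambda>e. cinner ((P k o\<^sub>L (adj (A k) o\<^sub>L B k)) e) e) has_sum s) ?E \<and>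
    ((\<lambda>e. cinner (P k (adj (A k) e)) (adj (B k) e)) has_sum s) ?E"
  proof
    fix k assume "k \<in> {1..n}"
    with P A B have "P k \<in> nonneg_ops" "A k \<in> hilbert_schmidt" "B k \<in> hilbert_schmidt"
      by (auto simp: nonneg_tuples_def)
    then show "\<exists>s. ((\<lambda>e. cinner ((P k o\<^sub>L (adj (A k) o\<^sub>L B k)) e) e) has_sum s) ?E \<and>
      ((\<lambda>e. cinner (P k (adj (A k) e)) (adj (B k) e)) has_sum s) ?E"
      using E by (rule hilbert_schmidt_trace_cyclic)
  qed
  from bchoice[OF this] obtain s where s: "\<forall>k\<in>{1..n}.
      ((\<lambda>e. cinner ((P k o\<^sub>L (adj (A k) o\<^sub>L B k)) e) e) has_sum s k) ?E"
    "\<forall>k\<in>{1..n}. ((\<lambda>e. cinner (P k (adj (A k) e)) (adj (B k) e)) has_sum s k) ?E"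
    by blast
  have "((\<lambda>e. cinner ((\<Sum>k=1..n. P k o\<^sub>L (adj (A k) o\<^sub>L B k)) e) e) has_sum (\<Sum>k=1..n. s k)) ?E"
    using has_sum_finite_sum[OF s(1)] by (simp add: blinfun.sum_left cinner_sum_left)
  then have "trace_form n P A B = (\<Sum>k=1..n. s k)"
    unfolding trace_form_def tr_def by (rule infsumI)
  then show ?thesis using has_sum_finite_sum[OF s(2)] by simp
qed

lemma sigma_tr_eq_trace_form:
  assumes "\<forall>k\<in>{1..n}. A k \<in> hilbert_schmidt"
    and "\<forall>k\<in>{1..n}. B k \<in> hilbert_schmidt"
  shows "sigma_tr n A B P =
    sqrt (Re (trace_form n P A A)) * sqrt (Re (trace_form n P B B)) - cmod (trace_form n P A B)"
proof -
  have "(\<Sum>k=1..n. P k o\<^sub>L (op_abs (C k) o\<^sub>L op_abs (C k))) = (\<Sum>k=1..n. P k o\<^sub>L (adj (C k) o\<^sub>L C k))"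
    if "\<forall>k\<in>{1..n}. C k \<in> hilbert_schmidt" for C :: "nat \<Rightarrow> 'a \<Rightarrow>\<^sub>L 'a"
    using that by (intro sum.cong) (simp_all add: op_abs_compose_self hilbert_schmidt_bounded)
  with assms show ?thesis by (simp add: sigma_tr_def trace_form_def)
qed

section \<open>Linearity in the weights, positivity and Cauchy-Schwarz for the trace form\<close>

lemma nonneg_tuples_add:
  "P \<in> nonneg_tuples n \<Longrightarrow> Q \<in> nonneg_tuples n \<Longrightarrow> (\<lambda>k. P k + Q k) \<in> nonneg_tuples n"
  by (simp add: nonneg_tuples_def nonneg_ops_add)

lemma nonneg_tuples_scaleR:
  "P \<in> nonneg_tuples n \<Longrightarrow> 0 \<le> r \<Longrightarrow> (\<lambda>k. r *\<^sub>R P k) \<in> nonneg_tuples n"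
  by (simp add: nonneg_tuples_def nonneg_ops_scaleR)

text \<open>This recovers the product form from the weighted estimate: for positive \<open>a\<close>
  and \<open>b\<close> the optimal \<open>t\<close> is \<open>sqrt b / sqrt a\<close>. If one of
  them is 0 the infimum is only approached, and a suitable \<open>t\<close> contradicts
  \<open>c > 0\<close>.\<close>

lemma le_sqrt_mult_sqrtI:
  fixes a b c :: real
  assumes ab: "0 \<le> a" "0 \<le> b" and le: "\<And>t. 0 < t \<Longrightarrow> 2 * c \<le> t * a + b / t"
  shows "c \<le> sqrt a * sqrt b"
proof (rule ccontr)
  assume "\<not> ?thesis"
  then have gt: "sqrt a * sqrt b < c" by simp
  have c: "0 < c" using gt ab by (meson le_less_trans mult_nonneg_nonneg real_sqrt_ge_zero)
  consider "a = 0" | "b = 0" | "0 < a" "0 < b" using ab by linarith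
  then show False
  proof cases
    case 1
    \<comment> \<open>With \<open>a = 0\<close> a large \<open>t\<close> is wanted; this one makes
      the right side \<open>c\<close> times \<open>b / (b + 1)\<close>, which is less than
      \<open>c\<close>. The case \<open>b = 0\<close> is symmetric with a small
      \<open>t\<close>.\<close>
    then have "2 * c \<le> b / ((b + 1) / c)" using le[of "(b + 1) / c"] ab c by simp
    also have "\<dots> < c" using ab c by (simp add: divide_simps)
    finally show False using c by simp
  next
    case 2
    then have "2 * c \<le> c / (a + 1) * a" using le[of "c / (a + 1)"] ab c by simp
    also have "\<dots> < c" using ab c by (simp add: divide_simps)
    finally show False using c by simp
  next
    case 3
    \<comment> \<open>At the optimal \<open>t\<close> both summands equal
      \<open>sqrt a * sqrt b\<close>.\<close>
    have "2 * c \<le> sqrt b / sqrt a * a + b / (sqrt b / sqrt a)" using le[of "sqrt b / sqrt a"] 3 by simp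
    also have "sqrt b / sqrt a * a = sqrt b * (a / sqrt a)" by simp
    also have "a / sqrt a = sqrt a" by (rule real_div_sqrt) (use 3 in simp)
    also have "b / (sqrt b / sqrt a) = b / sqrt b * sqrt a" by simp
    also have "b / sqrt b = sqrt b" by (rule real_div_sqrt) (use 3 in simp)
    finally show False using gt by (simp add: mult.commute)
  qed
qed

text \<open>After squaring, right minus left is exactly the square of
  \<open>sqrt a * sqrt d - sqrt b * sqrt c\<close>.\<close>

lemma sqrt_mult_sqrt_superadditive:
  fixes a b c d :: real
  assumes "0 \<le> a" "0 \<le> b" "0 \<le> c" "0 \<le> d"
  shows "sqrt a * sqrt b + sqrt c * sqrt d \<le> sqrt (a + c) * sqrt (b + d)"
proof -
  have "0 \<le> (sqrt a * sqrt d - sqrt b * sqrt c)\<^sup>2" by simp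
  then have "(sqrt a * sqrt b + sqrt c * sqrt d)\<^sup>2 \<le> (a + c) * (b + d)"
    using assms by (simp add: power2_sum power2_diff power_mult_distrib algebra_simps)
  then show ?thesis
    by (simp add: real_le_rsqrt flip: real_sqrt_mult)
qed

text \<open>Both sides are sums of one series that is termwise additive in the weights, so
  uniqueness of sums suffices.\<close>

lemma trace_form_add:
  fixes A :: "nat \<Rightarrow> 'a::complex_hilbert \<Rightarrow>\<^sub>L 'a"
  assumes A: "\<forall>k\<in>{1..n}. A k \<in> hilbert_schmidt"
    and B: "\<forall>k\<in>{1..n}. B k \<in> hilbert_schmidt"
    and E: "is_onb (SOME E :: 'a set. is_onb E)"
    and P: "P \<in> nonneg_tuples n" and Q: "Q \<in> nonneg_tuples n"
  shows "trace_form n (\<lambda>k. P k + Q k) A B = trace_form n P A B + trace_form n Q A B"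
proof (rule has_sum_unique)
  show "((\<lambda>e. \<Sum>k=1..n. cinner ((P k + Q k) (adj (A k) e)) (adj (B k) e)) has_sum
    trace_form n (\<lambda>k. P k + Q k) A B) (SOME E. is_onb E)"
    by (rule trace_form_has_sum[OF A B E nonneg_tuples_add[OF P Q]])
  show "((\<lambda>e. \<Sum>k=1..n. cinner ((P k + Q k) (adj (A k) e)) (adj (B k) e)) has_sum
    trace_form n P A B + trace_form n Q A B) (SOME E. is_onb E)"
    using has_sum_add[OF trace_form_has_sum[OF A B E P] trace_form_has_sum[OF A B E Q]]
    by (simp add: blinfun.add_left cinner_add_left sum.distrib)
qed

lemma trace_form_scaleR:
  fixes A :: "nat \<Rightarrow> 'a::complex_hilbert \<Rightarrow>\<^sub>L 'a"
  assumes A: "\<forall>k\<in>{1..n}. A k \<in> hilbert_schmidt"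
    and B: "\<forall>k\<in>{1..n}. B k \<in> hilbert_schmidt"
    and E: "is_onb (SOME E :: 'a set. is_onb E)"
    and P: "P \<in> nonneg_tuples n" and r: "0 \<le> r"
  shows "trace_form n (\<lambda>k. r *\<^sub>R P k) A B = of_real r * trace_form n P A B"
proof (rule has_sum_unique)
  show "((\<lambda>e. \<Sum>k=1..n. cinner ((r *\<^sub>R P k) (adj (A k) e)) (adj (B k) e)) has_sum
    trace_form n (\<lambda>k. r *\<^sub>R P k) A B) (SOME E. is_onb E)"
    by (rule trace_form_has_sum[OF A B E nonneg_tuples_scaleR[OF P r]])
  show "((\<lambda>e. \<Sum>k=1..n. cinner ((r *\<^sub>R P k) (adj (A k) e)) (adj (B k) e)) has_sum
    of_real r * trace_form n P A B) (SOME E. is_onb E)"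
    using has_sum_cmult_right[OF trace_form_has_sum[OF A B E P], of "of_real r"]
    by (simp add: blinfun.scaleR_left cinner_scaleR_left sum_distrib_left)
qed

lemma trace_form_nonneg:
  fixes A :: "nat \<Rightarrow> 'a::complex_hilbert \<Rightarrow>\<^sub>L 'a"
  assumes A: "\<forall>k\<in>{1..n}. A k \<in> hilbert_schmidt"
    and E: "is_onb (SOME E :: 'a set. is_onb E)"
    and P: "P \<in> nonneg_tuples n"
  shows "0 \<le> Re (trace_form n P A A)"
  by (rule has_sum_nonneg[OF has_sum_Re[OF trace_form_has_sum[OF A A E P]]])
    (use P in \<open>auto simp: Re_cinner nonneg_tuples_def intro!: sum_nonneg nonneg_ops_nonneg\<close>)

text \<open>For fixed \<open>t\<close> the estimate \<open>nonneg_ops_AM_GM\<close> holds for each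
  index and basis vector and adds up to the trace forms; \<open>le_sqrt_mult_sqrtI\<close> then
  optimises over \<open>t\<close>.\<close>

lemma trace_form_Cauchy_Schwarz:
  fixes A B :: "nat \<Rightarrow> 'a::complex_hilbert \<Rightarrow>\<^sub>L 'a"
  assumes A: "\<forall>k\<in>{1..n}. A k \<in> hilbert_schmidt"
    and B: "\<forall>k\<in>{1..n}. B k \<in> hilbert_schmidt"
    and E: "is_onb (SOME E :: 'a set. is_onb E)"
    and P: "P \<in> nonneg_tuples n"
  shows "cmod (trace_form n P A B) \<le> sqrt (Re (trace_form n P A A)) * sqrt (Re (trace_form n P B B))"
proof (rule le_sqrt_mult_sqrtI)
  show "0 \<le> Re (trace_form n P A A)" by (rule trace_form_nonneg[OF A E P])
  show "0 \<le> Re (trace_form n P B B)" by (rule trace_form_nonneg[OF B E P])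
  fix t :: real assume t: "0 < t"
  let ?a = "\<lambda>e. \<Sum>k=1..n. cinner (P k (adj (A k) e)) (adj (A k) e)"
  let ?b = "\<lambda>e. \<Sum>k=1..n. cinner (P k (adj (B k) e)) (adj (B k) e)"
  let ?c = "\<lambda>e. \<Sum>k=1..n. cinner (P k (adj (A k) e)) (adj (B k) e)"
  have "cmod (trace_form n P A B) \<le> (t * Re (trace_form n P A A) + Re (trace_form n P B B) / t) / 2"
  proof (rule norm_infsum_le[OF trace_form_has_sum[OF A B E P]])
    show "((\<lambda>e. (t * Re (?a e) + Re (?b e) / t) / 2)
      has_sum (t * Re (trace_form n P A A) + Re (trace_form n P B B) / t) / 2) (SOME E. is_onb E)"
      by (intro has_sum_divide_const has_sum_add has_sum_cmult_right has_sum_Re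
          trace_form_has_sum[OF A A E P] trace_form_has_sum[OF B B E P])
    fix e :: 'a
    have "cmod (?c e) \<le> (\<Sum>k=1..n. cmod (cinner (P k (adj (A k) e)) (adj (B k) e)))"
      by (rule norm_sum)
    also have "\<dots> \<le> (\<Sum>k=1..n. (t * inner (P k (adj (A k) e)) (adj (A k) e) +
        inner (P k (adj (B k) e)) (adj (B k) e) / t) / 2)"
    proof (rule sum_mono)
      fix k assume "k \<in> {1..n}"
      then have "P k \<in> nonneg_ops" using P by (simp add: nonneg_tuples_def)
      from nonneg_ops_AM_GM[OF this t, of "adj (A k) e" "adj (B k) e"]
      show "cmod (cinner (P k (adj (A k) e)) (adj (B k) e)) \<le>
        (t * inner (P k (adj (A k) e)) (adj (A k) e) + inner (P k (adj (B k) e)) (adj (B k) e) / t) / 2"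
        by simp
    qed
    also have "\<dots> = (t * Re (?a e) + Re (?b e) / t) / 2"
      by (simp add: Re_cinner sum.distrib sum_distrib_left sum_divide_distrib add_divide_distrib)
    finally show "cmod (?c e) \<le> (t * Re (?a e) + Re (?b e) / t) / 2" .
  qed
  then show "2 * cmod (trace_form n P A B) \<le> t * Re (trace_form n P A A) + Re (trace_form n P B B) / t"
    by simp
qed

theorem proposition3:
  fixes A B :: "nat \<Rightarrow> 'a::complex_hilbert \<Rightarrow>\<^sub>L 'a" and n :: nat
  assumes "2 \<le> n"
    and "\<And>k. k \<in> {1..n} \<Longrightarrow> A k \<in> hilbert_schmidt"
    and "\<And>k. k \<in> {1..n} \<Longrightarrow> B k \<in> hilbert_schmidt"
  shows
    "(\<forall>P\<in>nonneg_tuples n. \<forall>Q\<in>nonneg_tuples n.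
        sigma_tr n A B (\<lambda>k. P k + Q k) \<ge> sigma_tr n A B P + sigma_tr n A B Q \<and>
        sigma_tr n A B P + sigma_tr n A B Q \<ge> 0) \<and>
     (\<forall>P\<in>nonneg_tuples n. \<forall>Q\<in>nonneg_tuples n. tuple_le n Q P \<longrightarrow>
        sigma_tr n A B P \<ge> sigma_tr n A B Q \<and> sigma_tr n A B Q \<ge> 0) \<and>
     (\<forall>P\<in>nonneg_tuples n. \<forall>Q\<in>nonneg_tuples n. \<forall>M m :: real.
        M > m \<and> m > 0 \<and> tuple_le n P (\<lambda>k. M *\<^sub>R Q k) \<and> tuple_le n (\<lambda>k. m *\<^sub>R Q k) P \<longrightarrow>
        M * sigma_tr n A B Q \<ge> sigma_tr n A B P \<and>
        sigma_tr n A B P \<ge> m * sigma_tr n A B Q \<and> m * sigma_tr n A B Q \<ge> 0)"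
proof -
  have A: "\<forall>k\<in>{1..n}. A k \<in> hilbert_schmidt" and B: "\<forall>k\<in>{1..n}. B k \<in> hilbert_schmidt"
    using assms(2,3) by blast+
  \<comment> \<open>The index 1 lies in the range because \<open>n\<close> is at least 2, so
    \<open>A 1\<close> supplies a basis.\<close>
  have E: "is_onb (SOME E :: 'a set. is_onb E)"
    using is_onb_some[of "A 1"] A \<open>2 \<le> n\<close> by simp
  note sigma = sigma_tr_eq_trace_form[OF A B]
  have nonneg: "0 \<le> sigma_tr n A B P" if "P \<in> nonneg_tuples n" for P
    using trace_form_Cauchy_Schwarz[OF A B E that] by (simp add: sigma)
  have superadditive: "sigma_tr n A B P + sigma_tr n A B Q \<le> sigma_tr n A B (\<lambda>k. P k + Q k)"
    if P: "P \<in> nonneg_tuples n" and Q: "Q \<in> nonneg_tuples n" for P Q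
  proof -
    have "cmod (trace_form n P A B + trace_form n Q A B) \<le> cmod (trace_form n P A B) + cmod (trace_form n Q A B)"
      by (rule norm_triangle_ineq)
    moreover note sqrt_mult_sqrt_superadditive[OF trace_form_nonneg[OF A E P]
        trace_form_nonneg[OF B E P] trace_form_nonneg[OF A E Q] trace_form_nonneg[OF B E Q]]
    ultimately show ?thesis
      by (simp add: sigma trace_form_add[OF A A E P Q] trace_form_add[OF A B E P Q]
          trace_form_add[OF B B E P Q])
  qed
  \<comment> \<open>Each square root contributes \<open>sqrt r\<close>, and the two multiply to
    \<open>r\<close>, the factor of the modulus.\<close>
  have homogeneous: "sigma_tr n A B (\<lambda>k. r *\<^sub>R P k) = r * sigma_tr n A B P"
    if P: "P \<in> nonneg_tuples n" and r: "0 \<le> r" for P r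
    using r by (simp add: sigma trace_form_scaleR[OF A A E P r] trace_form_scaleR[OF A B E P r]
        trace_form_scaleR[OF B B E P r] real_sqrt_mult norm_mult algebra_simps)
  have mono: "sigma_tr n A B Q \<le> sigma_tr n A B P"
    if P: "P \<in> nonneg_tuples n" and Q: "Q \<in> nonneg_tuples n" and le: "tuple_le n Q P" for P Q
  proof -
    have D: "(\<lambda>k. P k - Q k) \<in> nonneg_tuples n"
      using le by (simp add: nonneg_tuples_def tuple_le_def op_le_def)
    have "sigma_tr n A B Q \<le> sigma_tr n A B Q + sigma_tr n A B (\<lambda>k. P k - Q k)"
      using nonneg[OF D] by simp
    also have "\<dots> \<le> sigma_tr n A B (\<lambda>k. Q k + (P k - Q k))" by (rule superadditive[OF Q D])
    finally show ?thesis by simp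
  qed
  \<comment> \<open>Both bounds are monotonicity between \<open>P\<close> and a multiple of
    \<open>Q\<close>, with the constant then pulled out by homogeneity.\<close>
  have bounds: "M * sigma_tr n A B Q \<ge> sigma_tr n A B P \<and>
      sigma_tr n A B P \<ge> m * sigma_tr n A B Q \<and> m * sigma_tr n A B Q \<ge> 0"
    if P: "P \<in> nonneg_tuples n" and Q: "Q \<in> nonneg_tuples n"
      and M: "M > m" "m > 0" "tuple_le n P (\<lambda>k. M *\<^sub>R Q k)" "tuple_le n (\<lambda>k. m *\<^sub>R Q k) P" for P Q M m
    using mono[OF nonneg_tuples_scaleR[OF Q, of M] P M(3)] mono[OF P nonneg_tuples_scaleR[OF Q, of m] M(4)]
      homogeneous[OF Q, of M] homogeneous[OF Q, of m] nonneg[OF Q] M(1,2) by simp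
  show ?thesis
    by (intro conjI ballI allI impI) (use superadditive nonneg mono bounds in \<open>auto intro: add_nonneg_nonneg\<close>)
qed

end
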